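(* Let $G$ be a finite simple connected graph containing at least one cycle. For $f \in P(G)$ let $g(f)$ be the girth of $G$ weighted by $f$, let $\lambda_1(f)$ be the smallest positive eigenvalue of the weighted Laplacian $\Delta_f$, and let $\log\det^*\Delta_f=\sum_{i=1}^{n-1}\log\lambda_i(f)$. Then the functions $f\mapsto -g(f)$, $f\mapsto -\lambda_1(f)$ and $f\mapsto -\log\det^*\Delta_f$ are convex on $P(G)$, and hence also on $T(G)$ and $C(G)$.
   Context: $G$ has vertex set $V(G)$ with $n$ vertices and edge set $E(G)$; $d_v$ is the degree of $v$. $P(G)=\{f:E(G)\to(0,\infty) : \sum_{e\in E(G)} f(e)=|E(G)|\}$. $T(G)=\{f\in P(G): \sum_{e \text{ incident to } v} f(e)=d_v \text{ for all } v\in V(G)\}$. $C(G)=\{f\in P(G): \exists\, g:V(G)\to(0,\infty) \text{ with } f(e_{vw})=g(v)+g(w) \text{ for every edge } e_{vw} \text{ joining } v,w\}$. The length of a path or cycle is the sum of the weights $f(e)$ of its edges; the girth $g(f)$ is the minimal length of a cycle of $G$. The weighted Laplacian acts on $u:V(G)\to\mathbb{R}$ by $(\Delta_f u)(v)=\sum_{w\sim v} f(vw)(u(v)-u(w))$; its eigenvalues are $0=\lambda_0<\lambda_1\le\dots\le\lambda_{n-1}$ (for $G$ connected and $f>0$). *)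

theory Defs
  imports "HOL-Analysis.Analysis" "HOL-Library.Multiset"
begin

(* A graph has vertex set UNIV :: 'v set, where 'v is a finite type, and is given by its
   set E of edges. *)

definition simple_graph :: "'v::finite set set \<Rightarrow> bool" where
  "simple_graph E \<longleftrightarrow> (\<forall>e\<in>E. card e = 2)"

definition connected_graph :: "'v::finite set set \<Rightarrow> bool" where
  "connected_graph E \<longleftrightarrow> (\<forall>v w. (v, w) \<in> {(x, y). {x, y} \<in> E}\<^sup>*)"

definition degree :: "'v::finite set set \<Rightarrow> 'v \<Rightarrow> nat" where
  "degree E v = card {e \<in> E. v \<in> e}"

definition cyc_edge :: "'v list \<Rightarrow> nat \<Rightarrow> 'v set" where
  "cyc_edge p i = {p ! i, p ! (Suc i mod length p)}"

definition is_cycle :: "'v::finite set set \<Rightarrow> 'v list \<Rightarrow> bool" where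
  "is_cycle E p \<longleftrightarrow>
     length p \<ge> 3 \<and> distinct p \<and> (\<forall>i<length p. cyc_edge p i \<in> E)"

(* Weights E \<Rightarrow> \<real> are encoded as vectors indexed by all vertex sets that vanish outside E,
   so that they live in a real vector space. *)

type_synonym 'v weight = "(real, 'v set) vec"

definition P_set :: "'v::finite set set \<Rightarrow> 'v weight set" where
  "P_set E = {f. (\<forall>e\<in>E. f $ e > 0) \<and> (\<forall>e. e \<notin> E \<longrightarrow> f $ e = 0)
                 \<and> (\<Sum>e\<in>E. f $ e) = real (card E)}"

definition T_set :: "'v::finite set set \<Rightarrow> 'v weight set" where
  "T_set E = {f \<in> P_set E. \<forall>v. (\<Sum>e\<in>{e \<in> E. v \<in> e}. f $ e) = real (degree E v)}"

definition C_set :: "'v::finite set set \<Rightarrow> 'v weight set" where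
  "C_set E = {f \<in> P_set E. \<exists>g :: 'v \<Rightarrow> real. (\<forall>v. g v > 0) \<and>
                (\<forall>v w. {v, w} \<in> E \<longrightarrow> f $ {v, w} = g v + g w)}"

definition cycle_length :: "'v::finite weight \<Rightarrow> 'v list \<Rightarrow> real" where
  "cycle_length f p = (\<Sum>i<length p. f $ cyc_edge p i)"

definition girth :: "'v::finite set set \<Rightarrow> 'v weight \<Rightarrow> real" where
  "girth E f = Min {cycle_length f p | p. is_cycle E p}"

definition laplacian :: "'v::finite set set \<Rightarrow> 'v weight \<Rightarrow> real ^ 'v \<Rightarrow> real ^ 'v" where
  "laplacian E f u = (\<chi> v. \<Sum>w | {v, w} \<in> E. f $ {v, w} * (u $ v - u $ w))"

definition eigenspace :: "'v::finite set set \<Rightarrow> 'v weight \<Rightarrow> real \<Rightarrow> (real ^ 'v) set" where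
  "eigenspace E f \<mu> = {u. laplacian E f u = \<mu> *\<^sub>R u}"

definition eigenvalues :: "'v::finite set set \<Rightarrow> 'v weight \<Rightarrow> real set" where
  "eigenvalues E f = {\<mu>. \<exists>u. u \<noteq> 0 \<and> u \<in> eigenspace E f \<mu>}"

(* The eigenvalues in increasing order, repeated according to multiplicity.  The Laplacian is
   self-adjoint, so the multiplicity of an eigenvalue is the dimension of its eigenspace. *)

definition eigenvalue_list :: "'v::finite set set \<Rightarrow> 'v weight \<Rightarrow> real list" where
  "eigenvalue_list E f = sorted_list_of_multiset
     (\<Sum>\<mu>\<in>eigenvalues E f. replicate_mset (dim (eigenspace E f \<mu>)) \<mu>)"

definition eigval :: "'v::finite set set \<Rightarrow> 'v weight \<Rightarrow> nat \<Rightarrow> real" where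
  "eigval E f i = eigenvalue_list E f ! i"

definition lambda1 :: "'v::finite set set \<Rightarrow> 'v weight \<Rightarrow> real" where
  "lambda1 E f = Min {\<mu> \<in> eigenvalues E f. \<mu> > 0}"

definition log_det_star :: "'v::finite set set \<Rightarrow> 'v weight \<Rightarrow> real" where
  "log_det_star E f = (\<Sum>i = 1..CARD('v) - 1. ln (eigval E f i))"

end

theory Submission
  imports Defs
begin

text \<open>The girth is a minimum of linear functions of \<open>f\<close>, and \<open>lambda1\<close> is the minimum of the Rayleigh
  quotients of \<open>f\<close> on the hyperplane orthogonal to the constants, which are linear in \<open>f\<close> as well.
  For the determinant let \<open>b\<close> run through an orthonormal eigenbasis, on that hyperplane, of the
  Laplacian of a convex combination \<open>h\<close> of \<open>f\<close> and \<open>g\<close>. Concavity of the logarithm bounds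
  \<open>\<Sum>b. ln (\<Delta>\<^sub>h b \<bullet> b)\<close>, the log-determinant of \<open>h\<close>, from below by the
  convex combination of \<open>\<Sum>b. ln (\<Delta>\<^sub>f b \<bullet> b)\<close> and \<open>\<Sum>b. ln (\<Delta>\<^sub>g b \<bullet> b)\<close>. By the Schur-Hadamard
  inequality these sums are at least the log-determinants of \<open>f\<close> and \<open>g\<close>.\<close>

section \<open>Self-adjoint operators\<close>

text \<open>An orthonormal basis of \<open>S\<close> made of eigenvectors. Each eigenvalue is
  recovered as the Rayleigh quotient \<open>A b \<bullet> b\<close>, so multiplicities become counts
  of basis vectors.\<close>

definition eigenbasis :: "('a::euclidean_space \<Rightarrow> 'a) \<Rightarrow> 'a set \<Rightarrow> 'a set \<Rightarrow> bool" where
  "eigenbasis A S B \<longleftrightarrow> pairwise orthogonal B \<and> (\<forall>b\<in>B. norm b = 1 \<and> A b = (A b \<bullet> b) *\<^sub>R b)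
     \<and> span B = S"

text \<open>Subtracting from \<open>x\<close> its projection on \<open>b\<close> lands in the
  orthogonal complement of \<open>b\<close> in \<open>S\<close>. This is the induction step of the
  spectral theorem, and it later adjoins the constant vector.\<close>

lemma eigenbasis_insert:
  assumes "eigenbasis A {x\<in>S. x \<bullet> b = 0} B" "norm b = 1" "A b = m *\<^sub>R b" "subspace S" "b \<in> S"
  shows "eigenbasis A S (insert b B)"
proof -
  have B: "pairwise orthogonal B" "\<And>c. c \<in> B \<Longrightarrow> norm c = 1 \<and> A c = (A c \<bullet> c) *\<^sub>R c"
    and sp: "span B = {x\<in>S. x \<bullet> b = 0}"
    using assms(1) by (auto simp: eigenbasis_def)
  have BS: "c \<in> S" "c \<bullet> b = 0" if "c \<in> B" for c
    using sp span_base[OF that] by auto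
  have bb: "b \<bullet> b = 1" using assms(2) by (simp add: norm_eq_1)
  have "x \<in> span (insert b B)" if "x \<in> S" for x
  proof -
    have "x - (x \<bullet> b) *\<^sub>R b \<in> {x\<in>S. x \<bullet> b = 0}"
      using assms(4,5) that bb by (auto simp: subspace_diff subspace_scale inner_diff_left)
    then show ?thesis
      unfolding sp[symmetric] span_insert by blast
  qed
  moreover have "span (insert b B) \<subseteq> S"
    by (rule span_minimal) (use BS assms in auto)
  ultimately have "span (insert b B) = S" by blast
  moreover have "pairwise orthogonal (insert b B)"
    using B(1) BS by (auto simp: pairwise_insert orthogonal_def inner_commute)
  ultimately show ?thesis
    unfolding eigenbasis_def using B(2) assms(2,3) bb by auto
qed

lemma eigenbasis_finite: "eigenbasis A S B \<Longrightarrow> finite B"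
  unfolding eigenbasis_def using pairwise_orthogonal_imp_finite by blast

lemma eigenbasis_subset: "eigenbasis A S B \<Longrightarrow> B \<subseteq> S"
  unfolding eigenbasis_def using span_superset by blast

lemma eigenbasis_independent:
  assumes "eigenbasis A S B" shows "independent B"
  using assms unfolding eigenbasis_def
  by (intro pairwise_orthogonal_independent) auto

lemma eigenbasis_card: "eigenbasis A S B \<Longrightarrow> card B = dim S"
  using dim_span_eq_card_independent[OF eigenbasis_independent, of A S B]
  by (auto simp: eigenbasis_def)

lemma eigenbasis_expand:
  assumes "eigenbasis A S B" "x \<in> S" shows "(\<Sum>b\<in>B. (x \<bullet> b) *\<^sub>R b) = x"
  using assms eigenbasis_finite[OF assms(1)]
  by (intro orthonormal_basis_expand) (auto simp: eigenbasis_def)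

lemma eigenbasis_parseval:
  assumes "eigenbasis A S B" "x \<in> S" shows "x \<bullet> x = (\<Sum>b\<in>B. (x \<bullet> b)\<^sup>2)"
proof -
  have "x \<bullet> x = (\<Sum>b\<in>B. (x \<bullet> b) *\<^sub>R b) \<bullet> x"
    by (simp add: eigenbasis_expand[OF assms])
  also have "\<dots> = (\<Sum>b\<in>B. (x \<bullet> b)\<^sup>2)"
    unfolding inner_sum_left by (simp add: inner_commute power2_eq_square)
  finally show ?thesis .
qed

text \<open>For a unit vector \<open>x\<close>, Parseval turns this into a weighted mean of the
  eigenvalues, which is the input for both Jensen's inequality and the Rayleigh bound.\<close>

lemma eigenbasis_quadratic_form:
  assumes "eigenbasis A S B" "x \<in> S" "linear A"
  shows "A x \<bullet> x = (\<Sum>b\<in>B. (A b \<bullet> b) * (x \<bullet> b)\<^sup>2)"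
proof -
  have "A x \<bullet> x = A (\<Sum>b\<in>B. (x \<bullet> b) *\<^sub>R b) \<bullet> x"
    by (simp add: eigenbasis_expand[OF assms(1,2)])
  also have "\<dots> = (\<Sum>b\<in>B. (x \<bullet> b) * (A b \<bullet> x))"
    by (simp add: linear_sum[OF assms(3)] linear_scale[OF assms(3)] inner_sum_left)
  also have "\<dots> = (\<Sum>b\<in>B. (x \<bullet> b) * (((A b \<bullet> b) *\<^sub>R b) \<bullet> x))"
    using assms(1) by (intro sum.cong refl) (simp add: eigenbasis_def)
  also have "\<dots> = (\<Sum>b\<in>B. (A b \<bullet> b) * (x \<bullet> b)\<^sup>2)"
    by (simp add: inner_commute power2_eq_square mult_ac)
  finally show ?thesis .
qed

text \<open>A maximizer of the Rayleigh quotient on the unit sphere of \<open>S\<close> is an eigenvector.\<close>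

lemma selfadjoint_eigenvector_exists:
  fixes A :: "'a::euclidean_space \<Rightarrow> 'a"
  assumes lin: "linear A" and sa: "\<And>x y. A x \<bullet> y = x \<bullet> A y"
    and S: "subspace S" "A ` S \<subseteq> S" "S \<noteq> {0}"
  obtains b where "b \<in> S" "norm b = 1" "A b = (A b \<bullet> b) *\<^sub>R b"
proof -
  obtain x where x: "x \<in> S" "x \<noteq> 0" using S subspace_0 by blast
  have "compact (sphere 0 1 \<inter> S)"
    using closed_subspace[OF S(1)] by (intro compact_Int_closed) auto
  moreover have "x /\<^sub>R norm x \<in> sphere 0 1 \<inter> S"
    using x S(1) by (auto simp: subspace_scale)
  moreover have "continuous_on (sphere 0 1 \<inter> S) (\<lambda>x. A x \<bullet> x)"
    using lin by (intro continuous_intros linear_continuous_on linear_conv_bounded_linear[THEN iffD1])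
  ultimately obtain b where b: "b \<in> sphere 0 1 \<inter> S"
    and max: "\<And>y. y \<in> sphere 0 1 \<inter> S \<Longrightarrow> A y \<bullet> y \<le> A b \<bullet> b"
    using continuous_attains_sup[of "sphere 0 1 \<inter> S" "\<lambda>x. A x \<bullet> x"] by blast
  define m where "m = A b \<bullet> b"
  have bb: "b \<bullet> b = 1" using b by (simp add: norm_eq_1)
  have ray: "A y \<bullet> y \<le> m * (y \<bullet> y)" if "y \<in> S" for y
  proof (cases "y = 0")
    case True
    then show ?thesis using linear_0[OF lin] by simp
  next
    case False
    have "A (y /\<^sub>R norm y) \<bullet> (y /\<^sub>R norm y) \<le> m"
      unfolding m_def using False that S(1) by (intro max) (auto simp: subspace_scale)
    then have "(A y \<bullet> y) / (norm y)\<^sup>2 \<le> m"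
      by (simp add: linear_scale[OF lin] power2_eq_square field_simps)
    then show ?thesis
      using False by (simp add: field_simps power2_norm_eq_inner)
  qed
  \<comment> \<open>The residual of the eigenvalue equation; the rest of the proof shows that it
    vanishes.\<close>
  define w where "w = A b - m *\<^sub>R b"
  have wS: "w \<in> S" unfolding w_def using S b by (auto intro!: subspace_diff subspace_scale)
  define C where "C = m * (w \<bullet> w) - A w \<bullet> w"
  \<comment> \<open>Moving from \<open>b\<close> in direction \<open>w\<close> changes the two sides
    of \<open>ray\<close> by amounts whose difference has first-order term
    \<open>2 * t * (w \<bullet> w)\<close>; the terms in \<open>b \<bullet> w\<close>
    cancel.\<close>
  have q: "2 * t * (w \<bullet> w) \<le> t\<^sup>2 * C" for t
  proof -
    have ineq: "A (b + t *\<^sub>R w) \<bullet> (b + t *\<^sub>R w) \<le> m * ((b + t *\<^sub>R w) \<bullet> (b + t *\<^sub>R w))"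
      using S b wS by (intro ray) (auto intro!: subspace_add subspace_scale)
    have form: "A (b + t *\<^sub>R w) \<bullet> (b + t *\<^sub>R w) = m + 2 * t * (A b \<bullet> w) + t\<^sup>2 * (A w \<bullet> w)"
    proof -
      have "A w \<bullet> b = A b \<bullet> w" by (metis sa inner_commute)
      then show ?thesis
        by (simp add: m_def linear_add[OF lin] linear_scale[OF lin] inner_add_left inner_add_right
            power2_eq_square algebra_simps)
    qed
    have sq: "(b + t *\<^sub>R w) \<bullet> (b + t *\<^sub>R w) = 1 + 2 * t * (b \<bullet> w) + t\<^sup>2 * (w \<bullet> w)"
      using bb by (simp add: inner_add_left inner_add_right inner_commute[of w b]
          power2_eq_square algebra_simps)
    have Abw: "A b \<bullet> w = w \<bullet> w + m * (b \<bullet> w)"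
      by (metis w_def inner_diff_left inner_scaleR_left diff_add_cancel)
    show ?thesis
      using ineq unfolding form sq Abw C_def by (simp add: algebra_simps)
  qed
  have "w \<bullet> w = 0"
  proof (rule ccontr)
    assume "w \<bullet> w \<noteq> 0"
    then have pos: "w \<bullet> w > 0" by simp
    \<comment> \<open>Small enough for the quadratic term to lose against the linear one; the
      summand 1 keeps the denominator positive.\<close>
    define t where "t = (w \<bullet> w) / (\<bar>C\<bar> + 1)"
    have "t > 0" using pos by (simp add: t_def)
    have "2 * (w \<bullet> w) \<le> t * C"
      using q[of t] \<open>t > 0\<close> by (simp add: power2_eq_square)
    also have "\<dots> \<le> t * (\<bar>C\<bar> + 1)" using \<open>t > 0\<close> by (intro mult_left_mono) auto
    also have "\<dots> = w \<bullet> w" by (simp add: t_def)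
    finally show False using pos by simp
  qed
  then have "A b = (A b \<bullet> b) *\<^sub>R b" by (simp add: w_def m_def)
  then show ?thesis using b by (intro that) auto
qed

text \<open>Spectral theorem by induction on the dimension: self-adjointness makes the orthogonal
  complement of an eigenvector in \<open>S\<close> invariant again.\<close>

theorem selfadjoint_eigenbasis_exists:
  fixes A :: "'a::euclidean_space \<Rightarrow> 'a"
  assumes lin: "linear A" and sa: "\<And>x y. A x \<bullet> y = x \<bullet> A y"
    and "subspace S" "A ` S \<subseteq> S"
  shows "\<exists>B. eigenbasis A S B"
  using assms(3,4)
proof (induction "dim S" arbitrary: S rule: less_induct)
  case less
  show ?case
  proof (cases "S = {0}")
    case True
    then have "eigenbasis A S {}" by (simp add: eigenbasis_def)
    then show ?thesis by blast
  next
    case False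
    obtain b where b: "b \<in> S" "norm b = 1" "A b = (A b \<bullet> b) *\<^sub>R b"
      using selfadjoint_eigenvector_exists[OF lin sa less.prems False] by blast
    define T where "T = {x\<in>S. x \<bullet> b = 0}"
    have T: "subspace T"
      using less.prems(1) by (auto simp: T_def subspace_def inner_add_left)
    have "A x \<bullet> b = 0" if "x \<bullet> b = 0" for x
      using b(3) that by (metis inner_scaleR_right mult_zero_right sa)
    then have "A ` T \<subseteq> T" using less.prems(2) by (auto simp: T_def)
    moreover have "b \<notin> T" using b(2) by (auto simp: T_def)
    then have "T \<subset> S" using b(1) T_def by blast
    then have "dim T < dim S"
      using T less.prems(1) by (intro dim_psubset) (simp add: span_eq_iff[THEN iffD2])
    ultimately obtain B where "eigenbasis A T B" using less.hyps T by blast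
    then show ?thesis
      using eigenbasis_insert[of A S b, OF _ b(2,3) less.prems(1) b(1)] unfolding T_def by blast
  qed
qed

text \<open>The numbers \<open>(b \<bullet> c)\<^sup>2\<close> form a doubly stochastic matrix, so this is Jensen's inequality
  for the logarithm, row by row.\<close>

lemma sum_ln_eigenvalues_le:
  assumes A: "eigenbasis A S C" "linear A" and B: "eigenbasis A' S B"
    and pos: "\<And>c. c \<in> C \<Longrightarrow> A c \<bullet> c > 0"
  shows "(\<Sum>c\<in>C. ln (A c \<bullet> c)) \<le> (\<Sum>b\<in>B. ln (A b \<bullet> b))"
proof -
  have BS: "b \<in> S" "b \<bullet> b = 1" if "b \<in> B" for b
    using that B eigenbasis_subset[OF B] by (auto simp: eigenbasis_def norm_eq_1)
  have CS: "c \<in> S" "c \<bullet> c = 1" if "c \<in> C" for c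
    using that A(1) eigenbasis_subset[OF A(1)] by (auto simp: eigenbasis_def norm_eq_1)
  \<comment> \<open>Rows and columns sum to 1 by Parseval for unit vectors, in the basis
    \<open>C\<close> and in the basis \<open>B\<close> respectively.\<close>
  have row: "(\<Sum>c\<in>C. (b \<bullet> c)\<^sup>2) = 1" if "b \<in> B" for b
    using eigenbasis_parseval[OF A(1) BS(1)] BS(2) that by simp
  have col: "(\<Sum>b\<in>B. (b \<bullet> c)\<^sup>2) = 1" if "c \<in> C" for c
    using eigenbasis_parseval[OF B CS(1)[OF that]] CS(2)[OF that]
    by (metis (no_types, lifting) inner_commute sum.cong)
  have jensen: "(\<Sum>c\<in>C. (b \<bullet> c)\<^sup>2 * ln (A c \<bullet> c)) \<le> ln (A b \<bullet> b)" if b: "b \<in> B" for b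
  proof -
    \<comment> \<open>Jensen's inequality needs a nonempty index set; an empty row could not sum to
      1.\<close>
    have "C \<noteq> {}" using row[OF b] by auto
    then have "(\<Sum>c\<in>C. (b \<bullet> c)\<^sup>2 * ln (A c \<bullet> c)) \<le> ln (\<Sum>c\<in>C. (b \<bullet> c)\<^sup>2 *\<^sub>R (A c \<bullet> c))"
      using concave_on_sum[OF eigenbasis_finite[OF A(1)] _ ln_concave row[OF b],
          where y = "\<lambda>c. A c \<bullet> c"] pos by simp
    then show ?thesis
      using eigenbasis_quadratic_form[OF A(1) BS(1)[OF b] A(2)] by (simp add: mult.commute)
  qed
  have "(\<Sum>c\<in>C. ln (A c \<bullet> c)) = (\<Sum>c\<in>C. (\<Sum>b\<in>B. (b \<bullet> c)\<^sup>2) * ln (A c \<bullet> c))"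
    using col by simp
  also have "\<dots> = (\<Sum>b\<in>B. \<Sum>c\<in>C. (b \<bullet> c)\<^sup>2 * ln (A c \<bullet> c))"
    unfolding sum_distrib_right by (rule sum.swap)
  also have "\<dots> \<le> (\<Sum>b\<in>B. ln (A b \<bullet> b))"
    using jensen by (rule sum_mono)
  finally show ?thesis .
qed

text \<open>Eigenvectors for distinct eigenvalues are orthogonal, so \<open>u\<close> has no
  component along basis vectors with an eigenvalue other than \<mu>.\<close>

lemma eigenbasis_eigenspace:
  assumes B: "eigenbasis A UNIV B" and lin: "linear A" and sa: "\<And>x y. A x \<bullet> y = x \<bullet> A y"
  shows "{u. A u = \<mu> *\<^sub>R u} = span {b\<in>B. A b \<bullet> b = \<mu>}"
proof
  show "span {b\<in>B. A b \<bullet> b = \<mu>} \<subseteq> {u. A u = \<mu> *\<^sub>R u}"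
  proof (rule span_minimal)
    show "{b\<in>B. A b \<bullet> b = \<mu>} \<subseteq> {u. A u = \<mu> *\<^sub>R u}"
      using B by (auto simp: eigenbasis_def)
    show "subspace {u. A u = \<mu> *\<^sub>R u}"
      using lin by (auto simp: subspace_def linear_0 linear_add linear_scale scaleR_add_right)
  qed
  show "{u. A u = \<mu> *\<^sub>R u} \<subseteq> span {b\<in>B. A b \<bullet> b = \<mu>}"
  proof
    fix u assume "u \<in> {u. A u = \<mu> *\<^sub>R u}"
    then have u: "A u = \<mu> *\<^sub>R u" by simp
    have "(u \<bullet> b) *\<^sub>R b \<in> span {b\<in>B. A b \<bullet> b = \<mu>}" if b: "b \<in> B" for b
    proof (cases "A b \<bullet> b = \<mu>")
      case True
      then show ?thesis using b by (simp add: span_base span_scale)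
    next
      case False
      have "u \<bullet> A b = (A b \<bullet> b) * (u \<bullet> b)"
        using B b unfolding eigenbasis_def by (metis inner_scaleR_right)
      then have "\<mu> * (u \<bullet> b) = (A b \<bullet> b) * (u \<bullet> b)"
        using sa[of u b] u by simp
      then have "u \<bullet> b = 0" using False by simp
      then show ?thesis by (simp add: span_zero)
    qed
    then have "(\<Sum>b\<in>B. (u \<bullet> b) *\<^sub>R b) \<in> span {b\<in>B. A b \<bullet> b = \<mu>}"
      by (intro span_sum)
    then show "u \<in> span {b\<in>B. A b \<bullet> b = \<mu>}"
      using eigenbasis_expand[OF B] by simp
  qed
qed

section \<open>The weighted Laplacian\<close>

text \<open>Weights vanish off \<open>E\<close>, so the sum may run over all vertices, which makes
  the double sums below symmetric.\<close>

lemma laplacian_component: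
  assumes "f \<in> P_set E"
  shows "laplacian E f u $ v = (\<Sum>w\<in>UNIV. f $ {v, w} * (u $ v - u $ w))"
  unfolding laplacian_def vec_lambda_beta
  by (rule sum.mono_neutral_left) (use assms in \<open>auto simp: P_set_def\<close>)

text \<open>The Dirichlet form, obtained by averaging the double sum with its copy under exchange of
  \<open>v\<close> and \<open>w\<close>. The factor 1/2 compensates for counting each edge in both
  directions.\<close>

lemma laplacian_inner:
  assumes "f \<in> P_set E"
  shows "laplacian E f u \<bullet> x
    = (\<Sum>v\<in>UNIV. \<Sum>w\<in>UNIV. f $ {v, w} * (u $ v - u $ w) * (x $ v - x $ w)) / 2"
proof -
  have 1: "laplacian E f u \<bullet> x = (\<Sum>v\<in>UNIV. \<Sum>w\<in>UNIV. f $ {v, w} * (u $ v - u $ w) * x $ v)"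
    by (simp add: inner_vec_def laplacian_component[OF assms] sum_distrib_right)
  have 2: "laplacian E f u \<bullet> x = (\<Sum>v\<in>UNIV. \<Sum>w\<in>UNIV. f $ {v, w} * (u $ w - u $ v) * x $ w)"
    unfolding 1 by (subst sum.swap) (simp add: insert_commute)
  have "2 * (laplacian E f u \<bullet> x)
    = (\<Sum>v\<in>UNIV. \<Sum>w\<in>UNIV. f $ {v, w} * (u $ v - u $ w) * x $ v)
      + (\<Sum>v\<in>UNIV. \<Sum>w\<in>UNIV. f $ {v, w} * (u $ w - u $ v) * x $ w)"
    using 1 2 by linarith
  also have "\<dots> = (\<Sum>v\<in>UNIV. \<Sum>w\<in>UNIV. f $ {v, w} * (u $ v - u $ w) * (x $ v - x $ w))"
    by (simp add: sum.distrib[symmetric] algebra_simps)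
  finally show ?thesis by simp
qed

lemma laplacian_selfadjoint:
  assumes "f \<in> P_set E"
  shows "laplacian E f u \<bullet> x = u \<bullet> laplacian E f x"
  unfolding inner_commute[of u] laplacian_inner[OF assms] by (simp add: mult_ac)

lemma linear_laplacian: "linear (laplacian E f)"
  by (rule linearI)
    (simp_all add: laplacian_def vec_eq_iff sum.distrib[symmetric] sum_distrib_left algebra_simps)

lemma laplacian_combination:
  "laplacian E (s *\<^sub>R f + t *\<^sub>R g) u = s *\<^sub>R laplacian E f u + t *\<^sub>R laplacian E g u"
  by (simp add: laplacian_def vec_eq_iff sum.distrib[symmetric] sum_distrib_left algebra_simps)

lemma laplacian_const: "laplacian E f (c *\<^sub>R 1) = 0"
  by (simp add: laplacian_def vec_eq_iff)

text \<open>Here \<open>1\<close> is the all-ones vector, so this is the orthogonal complement of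
  the constants.\<close>

abbreviation mean_zero :: "(real ^ 'v) set" where
  "mean_zero \<equiv> {u. u \<bullet> 1 = 0}"

lemma weight_nonneg: "f \<in> P_set E \<Longrightarrow> f $ e \<ge> 0"
  unfolding P_set_def by (cases "e \<in> E") (auto simp: less_imp_le)

text \<open>If the Dirichlet form vanishes, \<open>u\<close> agrees across every edge and so is
  constant by connectedness; a constant of mean zero is 0.\<close>

lemma laplacian_pos:
  assumes f: "f \<in> P_set E" and conn: "connected_graph E" and u: "u \<in> mean_zero" "u \<noteq> 0"
  shows "laplacian E f u \<bullet> u > 0"
proof -
  define q where "q v w = f $ {v, w} * (u $ v - u $ w) * (u $ v - u $ w)" for v w
  have nn: "q v w \<ge> 0" for v w
    using weight_nonneg[OF f] by (simp add: q_def mult.assoc)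
  have eq: "laplacian E f u \<bullet> u = (\<Sum>v\<in>UNIV. \<Sum>w\<in>UNIV. q v w) / 2"
    unfolding laplacian_inner[OF f] q_def ..
  have "laplacian E f u \<bullet> u \<noteq> 0"
  proof
    assume "laplacian E f u \<bullet> u = 0"
    then have "(\<Sum>v\<in>UNIV. \<Sum>w\<in>UNIV. q v w) = 0" by (simp add: eq)
    then have "q v w = 0" for v w
      using nn by (simp add: sum_nonneg_eq_0_iff sum_nonneg)
    then have edge: "u $ v = u $ w" if "{v, w} \<in> E" for v w
    proof -
      have "f $ {v, w} > 0" using that f by (simp add: P_set_def)
      then show ?thesis using \<open>q v w = 0\<close> by (simp add: q_def)
    qed
    have const: "u $ v = u $ w" for v w
    proof -
      have "(v, w) \<in> {(x, y). {x, y} \<in> E}\<^sup>*" using conn by (simp add: connected_graph_def)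
      then show ?thesis by (induction rule: rtrancl_induct) (auto simp: edge)
    qed
    obtain c where "u = c *\<^sub>R 1" using const by (auto simp: vec_eq_iff)
    then show False using u by simp
  qed
  moreover have "laplacian E f u \<bullet> u \<ge> 0"
    unfolding eq using nn by (simp add: sum_nonneg)
  ultimately show ?thesis by simp
qed

text \<open>Self-adjointness moves the operator onto the constant vector, which it kills.\<close>

lemma laplacian_mean_zero:
  assumes "f \<in> P_set E" shows "laplacian E f u \<in> mean_zero"
  using laplacian_selfadjoint[OF assms, of u 1] laplacian_const[of E f 1] by simp

lemma eigenbasis_mean_zero_exists:
  assumes "f \<in> P_set E"
  shows "\<exists>B. eigenbasis (laplacian E f) mean_zero B"
  using laplacian_mean_zero[OF assms] laplacian_selfadjoint[OF assms]
  by (intro selfadjoint_eigenbasis_exists linear_laplacian)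
    (auto simp: subspace_def inner_add_left)

lemma eigenbasis_mean_zero_pos:
  assumes "f \<in> P_set E" "connected_graph E" "eigenbasis (laplacian E f) mean_zero B" "b \<in> B"
  shows "laplacian E f b \<bullet> b > 0"
  using laplacian_pos[OF assms(1,2)] assms(3,4) eigenbasis_subset[OF assms(3)]
  by (force simp: eigenbasis_def)

lemma eigenbasis_mean_zero_card:
  fixes E :: "'v::finite set set"
  assumes "eigenbasis (laplacian E f) mean_zero B"
  shows "card B = CARD('v) - 1"
  using eigenbasis_card[OF assms] dim_hyperplane[of "1 :: real ^ 'v"]
  by (simp add: inner_commute)

section \<open>The spectrum read off from an eigenbasis\<close>

context
  fixes E :: "'v::finite set set" and f :: "'v weight" and B
  assumes f: "f \<in> P_set E" and conn: "connected_graph E"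
    and B: "eigenbasis (laplacian E f) mean_zero B"
begin

text \<open>The normalized constant vector supplies the missing eigenvalue 0. It is not in
  \<open>B\<close>, whose Rayleigh quotients are positive.\<close>

lemma full_eigenbasis:
  obtains j where "eigenbasis (laplacian E f) UNIV (insert j B)" "j \<notin> B"
    "laplacian E f j \<bullet> j = 0"
proof -
  define j :: "real ^ 'v" where "j = (1 / norm (1 :: real ^ 'v)) *\<^sub>R 1"
  have j: "norm j = 1" by (simp add: j_def)
  have L: "laplacian E f j = 0" unfolding j_def by (rule laplacian_const)
  have "{u\<in>UNIV. u \<bullet> j = 0} = mean_zero" by (auto simp: j_def)
  then have "eigenbasis (laplacian E f) UNIV (insert j B)"
    using B j L by (intro eigenbasis_insert[where m = 0]) auto
  moreover have "j \<notin> B" using eigenbasis_mean_zero_pos[OF f conn B, of j] L by auto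
  ultimately show ?thesis using that L by simp
qed

lemma dim_eigenspace:
  assumes "eigenbasis (laplacian E f) UNIV D"
  shows "dim (eigenspace E f \<mu>) = card {b\<in>D. laplacian E f b \<bullet> b = \<mu>}"
  unfolding eigenspace_def
    eigenbasis_eigenspace[OF assms linear_laplacian laplacian_selfadjoint[OF f]]
  by (intro dim_span_eq_card_independent independent_mono[OF eigenbasis_independent[OF assms]]) auto

lemma eigenvalues_eq_image:
  assumes D: "eigenbasis (laplacian E f) UNIV D"
  shows "eigenvalues E f = (\<lambda>b. laplacian E f b \<bullet> b) ` D"
proof -
  have "\<mu> \<in> eigenvalues E f \<longleftrightarrow> \<not> eigenspace E f \<mu> \<subseteq> {0}" for \<mu>
    by (auto simp: eigenvalues_def)
  also have "\<dots> \<mu> \<longleftrightarrow> dim (eigenspace E f \<mu>) \<noteq> 0" for \<mu> by (simp add: dim_eq_0)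
  finally have "\<mu> \<in> eigenvalues E f \<longleftrightarrow> card {b\<in>D. laplacian E f b \<bullet> b = \<mu>} \<noteq> 0" for \<mu>
    by (simp add: dim_eigenspace[OF D])
  then show ?thesis using eigenbasis_finite[OF D] by auto
qed

text \<open>Listing each eigenvalue with its multiplicity is the same as listing the Rayleigh
  quotients of a full eigenbasis; the 0 comes first because all others are positive.\<close>

lemma eigenvalue_list_eq:
  "eigenvalue_list E f
    = 0 # sorted_list_of_multiset (image_mset (\<lambda>b. laplacian E f b \<bullet> b) (mset_set B))"
proof -
  obtain j where D: "eigenbasis (laplacian E f) UNIV (insert j B)" "j \<notin> B"
    "laplacian E f j \<bullet> j = 0"
    by (rule full_eigenbasis)
  let ?l = "\<lambda>b. laplacian E f b \<bullet> b"
  let ?D = "insert j B"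
  let ?M = "image_mset ?l (mset_set B)"
  have fin: "finite ?D" using eigenbasis_finite[OF D(1)] .
  have "(\<Sum>\<mu>\<in>?l ` ?D. replicate_mset (card {b\<in>?D. ?l b = \<mu>}) \<mu>) = image_mset ?l (mset_set ?D)"
  proof (rule multiset_eqI)
    fix x
    have "count (\<Sum>\<mu>\<in>?l ` ?D. replicate_mset (card {b\<in>?D. ?l b = \<mu>}) \<mu>) x
      = (\<Sum>\<mu>\<in>?l ` ?D. if \<mu> = x then card {b\<in>?D. ?l b = \<mu>} else 0)"
      by (auto simp: count_sum intro!: sum.cong)
    \<comment> \<open>If \<open>x\<close> is not an eigenvalue, the sum picks no term and the set on
      the right is empty.\<close>
    also have "\<dots> = card {b\<in>?D. ?l b = x}"
      using fin by (auto simp: sum.delta card_eq_0_iff)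
    also have "\<dots> = count (image_mset ?l (mset_set ?D)) x"
      using fin by (simp add: count_image_mset' Collect_conj_eq conj_commute eq_commute)
    finally show "count (\<Sum>\<mu>\<in>?l ` ?D. replicate_mset (card {b\<in>?D. ?l b = \<mu>}) \<mu>) x
      = count (image_mset ?l (mset_set ?D)) x" .
  qed
  also have "\<dots> = add_mset 0 ?M"
    using D fin by simp
  finally have "eigenvalue_list E f = insort 0 (sorted_list_of_multiset ?M)"
    unfolding eigenvalue_list_def eigenvalues_eq_image[OF D(1)] dim_eigenspace[OF D(1)] by simp
  also have "\<dots> = 0 # sorted_list_of_multiset ?M"
    using eigenbasis_mean_zero_pos[OF f conn B] fin
    by (intro insort_is_Cons) (auto simp: less_imp_le)
  finally show ?thesis .
qed

text \<open>Starting the indices at 1 skips exactly the leading 0, and the sum over the remaining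
  entries ignores their order.\<close>

lemma log_det_star_eq: "log_det_star E f = (\<Sum>b\<in>B. ln (laplacian E f b \<bullet> b))"
proof -
  define xs where
    "xs = sorted_list_of_multiset (image_mset (\<lambda>b. laplacian E f b \<bullet> b) (mset_set B))"
  have ms: "mset xs = image_mset (\<lambda>b. laplacian E f b \<bullet> b) (mset_set B)"
    by (simp add: xs_def)
  \<comment> \<open>Matches the upper index in \<open>log_det_star\<close>, so no position beyond
    the end of the list is read.\<close>
  have len: "length xs = CARD('v) - 1"
    using arg_cong[OF ms, of size] eigenbasis_mean_zero_card[OF B] by simp
  have "log_det_star E f = (\<Sum>i = 1..length xs. ln ((0 # xs) ! i))"
    unfolding log_det_star_def eigval_def eigenvalue_list_eq xs_def[symmetric] len ..
  also have "\<dots> = (\<Sum>i<length xs. ln (xs ! i))"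
    by (rule sum.reindex_bij_witness[of _ Suc "\<lambda>i. i - 1"]) auto
  also have "\<dots> = sum_list (map ln xs)"
    by (simp add: sum_list_sum_nth atLeast0LessThan)
  also have "\<dots> = sum_mset (image_mset ln (mset xs))"
    by (metis mset_map sum_mset_sum_list)
  also have "\<dots> = (\<Sum>b\<in>B. ln (laplacian E f b \<bullet> b))"
    unfolding ms by (simp add: sum_unfold_sum_mset image_mset.compositionality comp_def)
  finally show ?thesis .
qed

lemma lambda1_eq_Min: "lambda1 E f = Min ((\<lambda>b. laplacian E f b \<bullet> b) ` B)"
proof -
  obtain j where D: "eigenbasis (laplacian E f) UNIV (insert j B)" "laplacian E f j \<bullet> j = 0"
    by (rule full_eigenbasis)
  have "{\<mu> \<in> eigenvalues E f. \<mu> > 0} = (\<lambda>b. laplacian E f b \<bullet> b) ` B"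
    unfolding eigenvalues_eq_image[OF D(1)] using D(2) eigenbasis_mean_zero_pos[OF f conn B] by auto
  then show ?thesis by (simp add: lambda1_def)
qed

text \<open>Replace each eigenvalue in the expansion of the quadratic form by the smallest one and
  apply Parseval.\<close>

lemma lambda1_le_rayleigh:
  assumes "u \<in> mean_zero"
  shows "lambda1 E f * (u \<bullet> u) \<le> laplacian E f u \<bullet> u"
proof -
  have "lambda1 E f * (u \<bullet> u) = (\<Sum>b\<in>B. lambda1 E f * (u \<bullet> b)\<^sup>2)"
    by (simp add: eigenbasis_parseval[OF B assms] sum_distrib_left)
  also have "\<dots> \<le> (\<Sum>b\<in>B. (laplacian E f b \<bullet> b) * (u \<bullet> b)\<^sup>2)"
    using eigenbasis_finite[OF B] by (intro sum_mono mult_right_mono) (auto simp: lambda1_eq_Min)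
  also have "\<dots> = laplacian E f u \<bullet> u"
    by (simp add: eigenbasis_quadratic_form[OF B assms linear_laplacian])
  finally show ?thesis .
qed

end

section \<open>Convexity\<close>

lemma convex_P_set: "convex (P_set E)"
proof (rule convexI)
  fix f g :: "'a weight" and s t :: real
  assume f: "f \<in> P_set E" and g: "g \<in> P_set E" and st: "0 \<le> s" "0 \<le> t" "s + t = 1"
  have "s * f $ e + t * g $ e > 0" if "e \<in> E" for e
  proof -
    have "f $ e > 0" "g $ e > 0" using f g that by (auto simp: P_set_def)
    \<comment> \<open>One coefficient may be 0, so strict positivity comes from whichever is
      positive.\<close>
    moreover have "s > 0 \<or> t > 0" using st by linarith
    ultimately show ?thesis
      using st by (auto intro: add_pos_nonneg add_nonneg_pos)
  qed
  moreover have "(\<Sum>e\<in>E. s * f $ e + t * g $ e) = (s + t) * real (card E)"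
    using f g by (simp add: P_set_def sum.distrib distrib_right flip: sum_distrib_left)
  ultimately show "s *\<^sub>R f + t *\<^sub>R g \<in> P_set E"
    using f g st by (simp add: P_set_def)
qed

lemma convex_T_set: "convex (T_set E)"
proof (rule convexI)
  fix f g :: "'a weight" and s t :: real
  assume f: "f \<in> T_set E" and g: "g \<in> T_set E" and st: "0 \<le> s" "0 \<le> t" "s + t = 1"
  have "s *\<^sub>R f + t *\<^sub>R g \<in> P_set E"
    using convexD[OF convex_P_set] f g st by (auto simp: T_set_def)
  moreover have "(\<Sum>e\<in>{e \<in> E. v \<in> e}. s * f $ e + t * g $ e) = (s + t) * real (degree E v)" for v
    using f g by (simp add: T_set_def sum.distrib distrib_right flip: sum_distrib_left)
  ultimately show "s *\<^sub>R f + t *\<^sub>R g \<in> T_set E"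
    using st by (simp add: T_set_def)
qed

lemma convex_C_set: "convex (C_set E)"
proof (rule convexI)
  fix f g :: "'a weight" and s t :: real
  assume f: "f \<in> C_set E" and g: "g \<in> C_set E" and st: "0 \<le> s" "0 \<le> t" "s + t = 1"
  obtain a where a: "\<And>v. a v > 0" "\<And>v w. {v, w} \<in> E \<Longrightarrow> f $ {v, w} = a v + a w"
    using f by (auto simp: C_set_def)
  obtain b where b: "\<And>v. b v > 0" "\<And>v w. {v, w} \<in> E \<Longrightarrow> g $ {v, w} = b v + b w"
    using g by (auto simp: C_set_def)
  have "s *\<^sub>R f + t *\<^sub>R g \<in> P_set E"
    using convexD[OF convex_P_set] f g st by (auto simp: C_set_def)
  \<comment> \<open>The same combination of the vertex functions \<open>a\<close> and
    \<open>b\<close> is the witness for the combined weight.\<close>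
  moreover have "s * a v + t * b v > 0" for v
  proof -
    have "s > 0 \<or> t > 0" using st by linarith
    then show ?thesis
      using st a(1)[of v] b(1)[of v] by (auto intro: add_pos_nonneg add_nonneg_pos)
  qed
  ultimately show "s *\<^sub>R f + t *\<^sub>R g \<in> C_set E"
    unfolding C_set_def
    by (auto intro!: exI[of _ "\<lambda>v. s * a v + t * b v"] simp: a(2) b(2) algebra_simps)
qed

section \<open>Concavity of the three functionals\<close>

lemma concave_girth:
  fixes E :: "'v::finite set set"
  assumes "\<exists>p. is_cycle E p" and S: "convex S"
  shows "concave_on S (girth E)"
  unfolding concave_on_iff
proof (intro conjI S ballI allI impI)
  fix f g :: "'v weight" and s t :: real
  assume st: "0 \<le> s" "0 \<le> t" "s + t = 1"
  let ?L = "\<lambda>f. {cycle_length f p | p. is_cycle E p}"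
  \<comment> \<open>Cycles are repetition-free lists over a finite type, so \<open>Min\<close> in
    the girth is a true minimum.\<close>
  have "finite {p :: 'v list. set p \<subseteq> UNIV \<and> distinct p}"
    by (rule finite_subset_distinct) simp
  then have "finite {p. is_cycle E p}"
    by (rule rev_finite_subset) (auto simp: is_cycle_def)
  then have fin: "finite (?L f)" for f by simp
  have ne: "?L f \<noteq> {}" for f using assms(1) by auto
  have le: "girth E f \<le> cycle_length f p" if "is_cycle E p" for f p
    unfolding girth_def using that by (intro Min_le fin) auto
  have "girth E (s *\<^sub>R f + t *\<^sub>R g) \<in> ?L (s *\<^sub>R f + t *\<^sub>R g)"
    unfolding girth_def by (rule Min_in[OF fin ne])
  \<comment> \<open>A shortest cycle for the combined weight is a competitor for both
    \<open>f\<close> and \<open>g\<close>, and its length is linear in the weight.\<close>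
  then obtain p where p: "is_cycle E p"
    "girth E (s *\<^sub>R f + t *\<^sub>R g) = cycle_length (s *\<^sub>R f + t *\<^sub>R g) p"
    by auto
  have "s * girth E f + t * girth E g \<le> s * cycle_length f p + t * cycle_length g p"
    using st le[OF p(1)] by (intro add_mono mult_left_mono) auto
  also have "\<dots> = girth E (s *\<^sub>R f + t *\<^sub>R g)"
    unfolding p(2) by (simp add: cycle_length_def sum.distrib sum_distrib_left)
  finally show "s * girth E f + t * girth E g \<le> girth E (s *\<^sub>R f + t *\<^sub>R g)" .
qed

lemma concave_lambda1:
  fixes E :: "'v::finite set set"
  assumes conn: "connected_graph E" and card: "CARD('v) \<ge> 2"
  shows "concave_on (P_set E) (lambda1 E)"
  unfolding concave_on_iff
proof (intro conjI convex_P_set ballI allI impI)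
  fix f g :: "'v weight" and s t :: real
  assume f: "f \<in> P_set E" and g: "g \<in> P_set E" and st: "0 \<le> s" "0 \<le> t" "s + t = 1"
  let ?h = "s *\<^sub>R f + t *\<^sub>R g"
  have h: "?h \<in> P_set E" using convexD[OF convex_P_set] f g st by blast
  obtain F where F: "eigenbasis (laplacian E f) mean_zero F"
    using eigenbasis_mean_zero_exists[OF f] ..
  obtain G where G: "eigenbasis (laplacian E g) mean_zero G"
    using eigenbasis_mean_zero_exists[OF g] ..
  obtain H where H: "eigenbasis (laplacian E ?h) mean_zero H"
    using eigenbasis_mean_zero_exists[OF h] ..
  \<comment> \<open>With two or more vertices \<open>mean_zero\<close> is nontrivial, so the minimum
    is attained at some \<open>b\<close>, which then serves as test vector for \<open>f\<close> and
    \<open>g\<close>.\<close>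
  have "H \<noteq> {}" using eigenbasis_mean_zero_card[OF H] card by auto
  then have "lambda1 E ?h \<in> (\<lambda>b. laplacian E ?h b \<bullet> b) ` H"
    unfolding lambda1_eq_Min[OF h conn H] using eigenbasis_finite[OF H] by (intro Min_in) auto
  then obtain b where b: "b \<in> H" "lambda1 E ?h = laplacian E ?h b \<bullet> b" by blast
  have bb: "b \<in> mean_zero" "b \<bullet> b = 1"
    using H b(1) eigenbasis_subset[OF H] by (auto simp: eigenbasis_def norm_eq_1)
  have "s * lambda1 E f + t * lambda1 E g \<le> s * (laplacian E f b \<bullet> b) + t * (laplacian E g b \<bullet> b)"
    using lambda1_le_rayleigh[OF f conn F bb(1)] lambda1_le_rayleigh[OF g conn G bb(1)] st bb(2)
    by (intro add_mono mult_left_mono) auto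
  also have "\<dots> = lambda1 E ?h"
    unfolding b(2) by (simp add: laplacian_combination inner_add_left)
  finally show "s * lambda1 E f + t * lambda1 E g \<le> lambda1 E ?h" .
qed

lemma concave_log_det_star:
  fixes E :: "'v::finite set set"
  assumes conn: "connected_graph E"
  shows "concave_on (P_set E) (log_det_star E)"
  unfolding concave_on_iff
proof (intro conjI convex_P_set ballI allI impI)
  fix f g :: "'v weight" and s t :: real
  assume f: "f \<in> P_set E" and g: "g \<in> P_set E" and st: "0 \<le> s" "0 \<le> t" "s + t = 1"
  let ?h = "s *\<^sub>R f + t *\<^sub>R g"
  have h: "?h \<in> P_set E" using convexD[OF convex_P_set] f g st by blast
  obtain F where F: "eigenbasis (laplacian E f) mean_zero F"
    using eigenbasis_mean_zero_exists[OF f] ..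
  obtain G where G: "eigenbasis (laplacian E g) mean_zero G"
    using eigenbasis_mean_zero_exists[OF g] ..
  obtain H where H: "eigenbasis (laplacian E ?h) mean_zero H"
    using eigenbasis_mean_zero_exists[OF h] ..
  \<comment> \<open>The vectors of \<open>H\<close> need not be eigenvectors for \<open>f\<close> or
    \<open>g\<close>, but their Rayleigh quotients are still positive, as concavity of
    \<open>ln\<close> requires.\<close>
  have pos: "laplacian E k b \<bullet> b > 0" if "k \<in> P_set E" "b \<in> H" for k b
    using that H eigenbasis_subset[OF H]
    by (intro laplacian_pos[OF _ conn]) (auto simp: eigenbasis_def)
  have "log_det_star E f \<le> (\<Sum>b\<in>H. ln (laplacian E f b \<bullet> b))"
    unfolding log_det_star_eq[OF f conn F]
    by (rule sum_ln_eigenvalues_le[OF F linear_laplacian H eigenbasis_mean_zero_pos[OF f conn F]])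
  moreover have "log_det_star E g \<le> (\<Sum>b\<in>H. ln (laplacian E g b \<bullet> b))"
    unfolding log_det_star_eq[OF g conn G]
    by (rule sum_ln_eigenvalues_le[OF G linear_laplacian H eigenbasis_mean_zero_pos[OF g conn G]])
  ultimately have "s * log_det_star E f + t * log_det_star E g
      \<le> s * (\<Sum>b\<in>H. ln (laplacian E f b \<bullet> b)) + t * (\<Sum>b\<in>H. ln (laplacian E g b \<bullet> b))"
    using st by (intro add_mono mult_left_mono) auto
  also have "\<dots> = (\<Sum>b\<in>H. s * ln (laplacian E f b \<bullet> b) + t * ln (laplacian E g b \<bullet> b))"
    by (simp add: sum.distrib sum_distrib_left)
  also have "\<dots> \<le> (\<Sum>b\<in>H. ln (laplacian E ?h b \<bullet> b))"
  proof (rule sum_mono)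
    fix b assume "b \<in> H"
    then have "s * ln (laplacian E f b \<bullet> b) + t * ln (laplacian E g b \<bullet> b)
        \<le> ln (s *\<^sub>R (laplacian E f b \<bullet> b) + t *\<^sub>R (laplacian E g b \<bullet> b))"
      using ln_concave pos[OF f] pos[OF g] st unfolding concave_on_iff by blast
    then show "s * ln (laplacian E f b \<bullet> b) + t * ln (laplacian E g b \<bullet> b)
        \<le> ln (laplacian E ?h b \<bullet> b)"
      by (simp add: laplacian_combination inner_add_left)
  qed
  also have "\<dots> = log_det_star E ?h"
    by (rule log_det_star_eq[OF h conn H, symmetric])
  finally show "s * log_det_star E f + t * log_det_star E g \<le> log_det_star E ?h" .
qed

theorem theorem1:
  fixes E :: "'v::finite set set"
  assumes "simple_graph E"
    and "connected_graph E"
    and "\<exists>p. is_cycle E p"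
  shows "convex_on (P_set E) (\<lambda>f. - girth E f)
       \<and> convex_on (P_set E) (\<lambda>f. - lambda1 E f)
       \<and> convex_on (P_set E) (\<lambda>f. - log_det_star E f)
       \<and> convex_on (T_set E) (\<lambda>f. - girth E f)
       \<and> convex_on (T_set E) (\<lambda>f. - lambda1 E f)
       \<and> convex_on (T_set E) (\<lambda>f. - log_det_star E f)
       \<and> convex_on (C_set E) (\<lambda>f. - girth E f)
       \<and> convex_on (C_set E) (\<lambda>f. - lambda1 E f)
       \<and> convex_on (C_set E) (\<lambda>f. - log_det_star E f)"
proof -
  obtain p where "is_cycle E p" using assms(3) ..
  \<comment> \<open>A cycle has at least three distinct vertices, which rules out the one-vertex
    graph, where \<open>lambda1\<close> would be a minimum over the empty set.\<close>
  then have "2 \<le> card (set p)" by (simp add: is_cycle_def distinct_card)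
  also have "\<dots> \<le> CARD('v)" by (rule card_mono) auto
  finally have card: "2 \<le> CARD('v)" .
  \<comment> \<open>\<open>convex_on\<close> includes convexity of the domain, so restricting to
    \<open>T_set\<close> and \<open>C_set\<close> calls for their own convexity proofs.\<close>
  have sub: "convex_on S F" if "convex_on (P_set E) F" "S \<subseteq> P_set E" "convex S"
    for S and F :: "'v weight \<Rightarrow> real"
    using that unfolding convex_on_def by blast
  have P: "convex_on (P_set E) (\<lambda>f. - girth E f)" "convex_on (P_set E) (\<lambda>f. - lambda1 E f)"
    "convex_on (P_set E) (\<lambda>f. - log_det_star E f)"
    using concave_girth[OF assms(3) convex_P_set] concave_lambda1[OF assms(2) card]
      concave_log_det_star[OF assms(2)]
    by (simp_all add: concave_on_def)
  have T: "T_set E \<subseteq> P_set E" and C: "C_set E \<subseteq> P_set E"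
    by (auto simp: T_set_def C_set_def)
  show ?thesis
    using P P[THEN sub, OF T convex_T_set] P[THEN sub, OF C convex_C_set] by blast
qed

end
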